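(* Let $h,s\in\mathbb{R}$ with $s\neq 0$, let $\zeta(h,s)$ be the set of zeros of the Ramanujan cubic polynomial $\rho(h,s,x)$, and let $\alpha\in\zeta(h,s)$. Then $$\zeta(h,s)=\left\{\alpha,\ \frac{s^2}{s-\alpha},\ -\frac{s(s-\alpha)}{\alpha}\right\}=\{\alpha,\eta_s(\alpha),\eta_s^2(\alpha)\},\qquad\text{where } \eta_s(z)=\frac{s^2}{s-z}.$$ Moreover, for any Ramanujan cubic polynomial $x^3+px^2+qx+r=\rho\left(\frac{p}{r^{1/3}},r^{1/3},x\right)$ we have $$\zeta\left(\frac{p}{r^{1/3}},r^{1/3}\right)=-r^{1/3}\,\zeta\left(\frac{p}{r^{1/3}},-1\right).$$
   Context: A Ramanujan cubic polynomial (RCP) is a cubic polynomial $x^3+px^2+qx+r$ with $p,q,r\in\mathbb{R}$, $r\neq 0$, all of whose zeros are real and whose coefficients satisfy $p\,r^{1/3}+3\,r^{2/3}+q=0$ (real cube roots). For $h,s\in\mathbb{R}$, $s\ne0$, set $\rho(h,s,x)=x^3+hsx^2-(h+3)s^2x+s^3$; the RCPs are exactly the polynomials $\rho(h,s,x)$, with $h=p/r^{1/3}$ and $s=r^{1/3}$. $\zeta(h,s)$ denotes the set of zeros of $\rho(h,s,x)$; $\eta_s^2$ denotes the composition $\eta_s\circ\eta_s$; for a number $c$ and a set $Z$ of numbers, $cZ=\{cz: z\in Z\}$. *)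

theory Defs
  imports "HOL-Computational_Algebra.Polynomial" Complex_Main
begin

(* Zeros are taken in the complex numbers, so that "all zeros are real" has content. *)
definition complex_zeros :: "real poly \<Rightarrow> complex set" where
  "complex_zeros P = {z. poly (map_poly complex_of_real P) z = 0}"

(* [:r, q, p, 1:] is x^3 + p x^2 + q x + r; root 3 is the real cube root, also for negative r. *)
definition ramanujan_cubic :: "real poly \<Rightarrow> bool" where
  "ramanujan_cubic P \<longleftrightarrow>
     (\<exists>p q r. P = [:r, q, p, 1:] \<and> r \<noteq> 0 \<and>
        complex_zeros P \<subseteq> \<real> \<and>
        p * root 3 r + 3 * (root 3 r)\<^sup>2 + q = 0)"

definition rho :: "real \<Rightarrow> real \<Rightarrow> real poly" where
  "rho h s = [:s ^ 3, - (h + 3) * s\<^sup>2, h * s, 1:]"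

definition zeta :: "real \<Rightarrow> real \<Rightarrow> complex set" where
  "zeta h s = complex_zeros (rho h s)"

(* For z = s the value is 0 by the convention x / 0 = 0; for s nonzero, s is never
   a zero of rho h s, since poly (rho h s) s = - (s ^ 3). *)
definition eta :: "real \<Rightarrow> complex \<Rightarrow> complex" where
  "eta s z = (complex_of_real s)\<^sup>2 / (complex_of_real s - z)"

end

theory Submission
  imports Defs
begin

text \<open>A zero \<open>a\<close> of \<open>\<rho>(h,s,x)\<close> is neither \<open>0\<close> nor \<open>s\<close>, and \<open>\<rho>(h,s,a) = 0\<close> is linear in \<open>h\<close>.
  Eliminating \<open>h\<close> from \<open>a (s - a) \<rho>(h,s,x)\<close> gives \<open>(x - a) ((s - a) x - s\<^sup>2) (a x + s (s - a))\<close>,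
  whose other zeros are those of the two linear factors. The second part is the homogeneity
  \<open>\<rho>(h,s,-s w) = -s\<^sup>3 \<rho>(h,-1,w)\<close>.\<close>

lemma mem_zeta_iff:
  "z \<in> zeta h s \<longleftrightarrow>
     z ^ 3 + of_real h * of_real s * z\<^sup>2 - (of_real h + 3) * (of_real s)\<^sup>2 * z + (of_real s) ^ 3 = 0"
  by (simp add: zeta_def complex_zeros_def rho_def map_poly_pCons algebra_simps power2_eq_square
      power3_eq_cube)

lemma zero_notin_zeta: "s \<noteq> 0 \<Longrightarrow> 0 \<notin> zeta h s"
  by (simp add: mem_zeta_iff)

lemma of_real_notin_zeta:
  assumes "s \<noteq> 0"
  shows "complex_of_real s \<notin> zeta h s"
proof -
  \<comment> \<open>The terms in \<open>k\<close> cancel, so at its own scale the cubic takes the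
    nonzero value \<open>- (z ^ 3)\<close> for every \<open>k\<close>.\<close>
  have "z ^ 3 + k * z * z\<^sup>2 - (k + 3) * z\<^sup>2 * z + z ^ 3 = - (z ^ 3)" for k z :: complex
    by algebra
  then show ?thesis
    unfolding mem_zeta_iff using assms
    by (simp only: of_real_eq_0_iff neg_equal_0_iff_equal power_eq_0_iff) simp
qed

text \<open>The left side minus the right side is \<open>- x * (x - s)\<close> times the cubic
  evaluated at \<open>a\<close>, which vanishes by assumption.\<close>

lemma cubic_factorization:
  fixes a h s x :: "'a :: idom"
  assumes "a ^ 3 + h * s * a\<^sup>2 - (h + 3) * s\<^sup>2 * a + s ^ 3 = 0"
  shows "a * (s - a) * (x ^ 3 + h * s * x\<^sup>2 - (h + 3) * s\<^sup>2 * x + s ^ 3) =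
           (x - a) * ((s - a) * x - s\<^sup>2) * (a * x + s * (s - a))"
  using assms by algebra

lemma zeta_eq:
  assumes s: "s \<noteq> 0" and a: "\<alpha> \<in> zeta h s"
  shows "zeta h s = {\<alpha>, (complex_of_real s)\<^sup>2 / (complex_of_real s - \<alpha>),
                     - (complex_of_real s * (complex_of_real s - \<alpha>) / \<alpha>)}"
proof (rule set_eqI)
  fix x
  let ?s = "complex_of_real s"
  have a0: "\<alpha> \<noteq> 0" and as: "?s - \<alpha> \<noteq> 0"
    using zero_notin_zeta[OF s] of_real_notin_zeta[OF s] a by force+
  \<comment> \<open>The factor \<open>\<alpha> * (?s - \<alpha>)\<close> is nonzero, so multiplying
    the cubic by it keeps the zeros.\<close>
  have "x \<in> zeta h s \<longleftrightarrow> (x - \<alpha>) * ((?s - \<alpha>) * x - ?s\<^sup>2) * (\<alpha> * x + ?s * (?s - \<alpha>)) = 0"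
    using a0 as by (simp add: cubic_factorization[OF a[unfolded mem_zeta_iff], symmetric] mem_zeta_iff)
  moreover have "(?s - \<alpha>) * x - ?s\<^sup>2 = 0 \<longleftrightarrow> x = ?s\<^sup>2 / (?s - \<alpha>)"
    using as by (simp add: eq_divide_eq mult.commute)
  moreover have "\<alpha> * x + ?s * (?s - \<alpha>) = 0 \<longleftrightarrow> x = - (?s * (?s - \<alpha>) / \<alpha>)"
    unfolding minus_divide_left eq_divide_eq using a0 by (simp add: eq_neg_iff_add_eq_0 mult.commute)
  ultimately show "x \<in> zeta h s \<longleftrightarrow>
      x \<in> {\<alpha>, ?s\<^sup>2 / (?s - \<alpha>), - (?s * (?s - \<alpha>) / \<alpha>)}"
    by simp
qed

lemma eta_eta:
  assumes "s \<noteq> 0" "z \<noteq> 0" "z \<noteq> complex_of_real s"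
  shows "eta s (eta s z) = - (complex_of_real s * (complex_of_real s - z) / z)"
proof -
  let ?s = "complex_of_real s"
  have d: "?s - z \<noteq> 0"
    using assms by simp
  \<comment> \<open>This is the denominator of the outer \<open>eta\<close>. It is nonzero, so the
    second iterate is a genuine quotient and \<open>s\<close> cancels once.\<close>
  then have "?s - eta s z = - (?s * z) / (?s - z)"
    unfolding eta_def by (simp add: field_simps power2_eq_square)
  then show ?thesis
    unfolding eta_def[of s "eta s z"] using assms d by (simp add: power2_eq_square)
qed

lemma zeta_scaling:
  assumes "s \<noteq> 0"
  shows "zeta h s = (\<lambda>z. complex_of_real (- s) * z) ` zeta h (-1)"
proof -
  \<comment> \<open>The right side is written as the cubic with scale \<open>- 1\<close>; the factor
    \<open>- (s ^ 3)\<close> is nonzero, so zeros correspond under scaling by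
    \<open>- s\<close>.\<close>
  have hom: "(- (s * w)) ^ 3 + h * s * (- (s * w))\<^sup>2 - (h + 3) * s\<^sup>2 * - (s * w) + s ^ 3 =
      - (s ^ 3) * (w ^ 3 + h * - 1 * w\<^sup>2 - (h + 3) * (- 1)\<^sup>2 * w + (- 1) ^ 3)"
    for h s w :: complex
    by algebra
  have mem: "complex_of_real (- s) * w \<in> zeta h s \<longleftrightarrow> w \<in> zeta h (-1)" for w
    unfolding mem_zeta_iff using assms hom[of s w h] by simp
  \<comment> \<open>For surjectivity, scaling by \<open>- s\<close> is undone by division.\<close>
  have "\<exists>w \<in> zeta h (-1). z = complex_of_real (- s) * w" if "z \<in> zeta h s" for z
  proof
    show z: "z = complex_of_real (- s) * (z / complex_of_real (- s))"
      using assms by simp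
    show "z / complex_of_real (- s) \<in> zeta h (-1)"
      using that z mem by metis
  qed
  then show ?thesis
    using mem by blast
qed

text \<open>With t = \<open>root 3 r\<close>, the choice h = p/t matches the quadratic coefficient,
  and t^3 = r holds for either sign of r because 3 is odd. The defining relation, solved for q,
  gives exactly -(h + 3) t^2.\<close>

lemma ramanujan_cubic_eq_rho:
  assumes "ramanujan_cubic [:r, q, p, 1:]"
  shows "[:r, q, p, 1:] = rho (p / root 3 r) (root 3 r)"
proof -
  let ?t = "root 3 r"
  have t: "?t \<noteq> 0" and "p * ?t + 3 * ?t\<^sup>2 + q = 0"
    using assms by (auto simp: ramanujan_cubic_def)
  then have "q = - (p * ?t + 3 * ?t\<^sup>2)"
    by linarith
  with t have "q = - (p / ?t + 3) * ?t\<^sup>2"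
    by (simp add: algebra_simps power2_eq_square)
  moreover have "?t ^ 3 = r"
    by (simp add: odd_real_root_pow)
  ultimately show ?thesis
    using t by (simp add: rho_def)
qed

theorem theorem8:
  shows "(\<forall>(h::real) (s::real) (\<alpha>::complex). s \<noteq> 0 \<longrightarrow> \<alpha> \<in> zeta h s \<longrightarrow>
            zeta h s = {\<alpha>,
                        (complex_of_real s)\<^sup>2 / (complex_of_real s - \<alpha>),
                        - (complex_of_real s * (complex_of_real s - \<alpha>) / \<alpha>)} \<and>
            zeta h s = {\<alpha>, eta s \<alpha>, (eta s \<circ> eta s) \<alpha>})
       \<and> (\<forall>(p::real) (q::real) (r::real). ramanujan_cubic [:r, q, p, 1:] \<longrightarrow>
            [:r, q, p, 1:] = rho (p / root 3 r) (root 3 r) \<and>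
            zeta (p / root 3 r) (root 3 r) =
              (\<lambda>z. complex_of_real (- root 3 r) * z) ` zeta (p / root 3 r) (-1))"
proof (intro conjI allI impI)
  fix h s \<alpha>
  assume s: "s \<noteq> 0" and a: "\<alpha> \<in> zeta h s"
  show "zeta h s = {\<alpha>, (complex_of_real s)\<^sup>2 / (complex_of_real s - \<alpha>),
                    - (complex_of_real s * (complex_of_real s - \<alpha>) / \<alpha>)}"
    using s a by (rule zeta_eq)
  have "\<alpha> \<noteq> 0" "\<alpha> \<noteq> complex_of_real s"
    using zero_notin_zeta[OF s] of_real_notin_zeta[OF s] a by force+
  then show "zeta h s = {\<alpha>, eta s \<alpha>, (eta s \<circ> eta s) \<alpha>}"
    unfolding comp_apply
    \<comment> \<open>Once the second iterate is replaced by its closed form, both sides are the set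
      from \<open>zeta_eq\<close>.\<close>
    by (subst eta_eta[OF s]) (simp_all only: zeta_eq[OF s a] eta_def not_False_eq_True)
next
  fix p q r
  assume rc: "ramanujan_cubic [:r, q, p, 1:]"
  then show "[:r, q, p, 1:] = rho (p / root 3 r) (root 3 r)"
    by (rule ramanujan_cubic_eq_rho)
  have "root 3 r \<noteq> 0"
    using rc by (simp add: ramanujan_cubic_def)
  then show "zeta (p / root 3 r) (root 3 r) =
      (\<lambda>z. complex_of_real (- root 3 r) * z) ` zeta (p / root 3 r) (-1)"
    by (rule zeta_scaling)
qed

end
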